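(* Let $G$ be a connected graph with vertex set $\{\mathbf{1},\mathbf{2},\dots,\mathbf{n}\}$, $n\ge 2$, let $\Phi=(F_1,F_2,\dots,F_n)$ be an ordered $n$-tuple of pairwise disjoint graphs with $|V(F_k)|\ge 3$ for all $k\in\{1,\dots,n\}$, and let $G[\Phi]$ be the generalized lexicographic product of $G$ and $\Phi$. Then $$G[\Phi]\langle\gamma\rangle = G[\Phi]\langle\gamma_r\rangle = G[\Phi]\langle\gamma^{oc}\rangle \quad\text{and}\quad G[\Phi]\langle\gamma_t\rangle = G[\Phi]\langle\gamma_{tr}\rangle = G[\Phi]\langle\gamma_t^{oc}\rangle .$$ If moreover $\gamma(F_k)\ge 3$ for all $k\in\{1,\dots,n\}$, then $$G[\Phi]\langle\gamma\rangle = G[\Phi]\langle\gamma_r\rangle = G[\Phi]\langle\gamma^{oc}\rangle = G[\Phi]\langle\gamma_t\rangle = G[\Phi]\langle\gamma_{tr}\rangle = G[\Phi]\langle\gamma_t^{oc}\rangle .$$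
   Context: All graphs are finite, simple, undirected (and have at least one vertex). Generalized lexicographic product: for a graph $G$ with $V(G)=\{\mathbf{1},\dots,\mathbf{n}\}$ and pairwise disjoint graphs $\Phi=(F_1,\dots,F_n)$, $G[\Phi]$ is the graph with vertex set $\bigcup_{i=1}^n V(F_i)$ such that each $F_i$ is an induced subgraph of $G[\Phi]$, and for $x\in V(F_i)$, $y\in V(F_j)$ with $i\ne j$, $xy$ is an edge of $G[\Phi]$ if and only if $\mathbf{i}\mathbf{j}\in E(G)$. Domination parameters of a graph $X$: a set $D\subseteq V(X)$ is dominating if every vertex of $V(X)-D$ has a neighbor in $D$; total dominating if every vertex of $V(X)$ has a neighbor in $D$. A dominating set $R$ is restrained dominating if every vertex of $V(X)-R$ has a neighbor in $V(X)-R$, and outer-connected dominating if $V(X)-R$ induces a connected graph. The numbers $\gamma(X),\gamma_t(X),\gamma_r(X),\gamma^{oc}(X)$ are the minimum cardinalities of, respectively, a dominating, total dominating, restrained dominating, outer-connected dominating set; $\gamma_{tr}(X)$ is the minimum cardinality of a set that is both total dominating and restrained dominating; $\gamma_t^{oc}(X)$ is the minimum cardinality of a set that is both total dominating and outer-connected dominating. For each such parameter $\mu$, a $\mu$-set of $X$ is a set of the corresponding type with cardinality $\mu(X)$. For a graph $H$, a graph $X$ is $H$-$\mu$-excellent if (i) for each $x\in V(X)$ there is an induced subgraph $H_x$ of $X$ isomorphic to $H$ with $x\in V(H_x)$ and $V(H_x)$ contained in some $\mu$-set of $X$; and (ii) for each induced subgraph $H'$ of $X$ isomorphic to $H$ there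 is a $\mu$-set of $X$ containing $V(H')$. $X\langle\mu\rangle$ denotes the family of all graphs $H$ (up to isomorphism) for which $X$ is $H$-$\mu$-excellent. *)

theory Defs
  imports "Graph_Theory.Digraph_Isomorphism" "HOL-Library.Disjoint_Sets"
begin

text \<open>
  A simple undirected graph is a finite, loop-free digraph without parallel arcs whose arc
  relation is symmetric (an edge \<open>xy\<close> being the pair of arcs \<open>(x,y)\<close>, \<open>(y,x)\<close>).  The locale
  predicate \<open>pair_graph\<close> admits the null graph, which is excluded here.
\<close>

definition simple_graph :: "'a pair_pre_digraph \<Rightarrow> bool" where
  "simple_graph X \<longleftrightarrow> pair_graph X \<and> pverts X \<noteq> {}"

definition gen_lex_prod ::
    "'i pair_pre_digraph \<Rightarrow> ('i \<Rightarrow> 'a pair_pre_digraph) \<Rightarrow> 'a pair_pre_digraph" where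
  "gen_lex_prod G F =
     \<lparr> pverts = (\<Union>i\<in>pverts G. pverts (F i)),
       parcs = (\<Union>i\<in>pverts G. parcs (F i)) \<union>
         {(x, y). \<exists>i\<in>pverts G. \<exists>j\<in>pverts G. i \<noteq> j \<and> x \<in> pverts (F i) \<and> y \<in> pverts (F j)
                    \<and> (i, j) \<in> parcs G} \<rparr>"


definition dominating :: "'a pair_pre_digraph \<Rightarrow> 'a set \<Rightarrow> bool" where
  "dominating X D \<longleftrightarrow> D \<subseteq> pverts X \<and> (\<forall>v\<in>pverts X - D. \<exists>u\<in>D. (v, u) \<in> parcs X)"

definition total_dominating :: "'a pair_pre_digraph \<Rightarrow> 'a set \<Rightarrow> bool" where
  "total_dominating X D \<longleftrightarrow> D \<subseteq> pverts X \<and> (\<forall>v\<in>pverts X. \<exists>u\<in>D. (v, u) \<in> parcs X)"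

definition restrained_dominating :: "'a pair_pre_digraph \<Rightarrow> 'a set \<Rightarrow> bool" where
  "restrained_dominating X R \<longleftrightarrow>
     dominating X R \<and> (\<forall>v\<in>pverts X - R. \<exists>u\<in>pverts X - R. (v, u) \<in> parcs X)"

text \<open>
  The library's \<open>connected\<close> is false for the null graph, so the complement of an outer-connected
  dominating set is nonempty.
\<close>

definition outer_connected_dominating :: "'a pair_pre_digraph \<Rightarrow> 'a set \<Rightarrow> bool" where
  "outer_connected_dominating X R \<longleftrightarrow>
     dominating X R \<and>
     Digraph_Component.connected (induce_subgraph (with_proj X) (pverts X - R))"

definition total_restrained_dominating :: "'a pair_pre_digraph \<Rightarrow> 'a set \<Rightarrow> bool" where
  "total_restrained_dominating X R \<longleftrightarrow> total_dominating X R \<and> restrained_dominating X R"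

definition total_outer_connected_dominating :: "'a pair_pre_digraph \<Rightarrow> 'a set \<Rightarrow> bool" where
  "total_outer_connected_dominating X R \<longleftrightarrow>
     total_dominating X R \<and> outer_connected_dominating X R"


text \<open>
  A domination parameter \<open>\<mu>\<close> is represented by the property \<open>P\<close> of vertex sets whose minimum
  cardinality it is.  If no set has the property, the value of \<open>min_card\<close> is meaningless, but
  then there is no \<open>\<mu>\<close>-set either.
\<close>

definition min_card ::
    "('a pair_pre_digraph \<Rightarrow> 'a set \<Rightarrow> bool) \<Rightarrow> 'a pair_pre_digraph \<Rightarrow> nat" where
  "min_card P X = (LEAST k. \<exists>D. P X D \<and> card D = k)"

definition min_set ::
    "('a pair_pre_digraph \<Rightarrow> 'a set \<Rightarrow> bool) \<Rightarrow> 'a pair_pre_digraph \<Rightarrow> 'a set \<Rightarrow> bool" where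
  "min_set P X D \<longleftrightarrow> P X D \<and> card D = min_card P X"

abbreviation domination_number :: "'a pair_pre_digraph \<Rightarrow> nat" where
  "domination_number \<equiv> min_card dominating"

definition excellent ::
    "'h pair_pre_digraph \<Rightarrow> ('a pair_pre_digraph \<Rightarrow> 'a set \<Rightarrow> bool) \<Rightarrow> 'a pair_pre_digraph \<Rightarrow> bool"
  where
  "excellent H P X \<longleftrightarrow>
     (\<forall>x\<in>pverts X. \<exists>K :: 'a pair_pre_digraph.
        induced_subgraph (with_proj K) (with_proj X) \<and> digraph_iso (with_proj K) (with_proj H) \<and>
        x \<in> pverts K \<and> (\<exists>D. min_set P X D \<and> pverts K \<subseteq> D)) \<and>
     (\<forall>K :: 'a pair_pre_digraph.
        induced_subgraph (with_proj K) (with_proj X) \<and> digraph_iso (with_proj K) (with_proj H) \<longrightarrow>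
        (\<exists>D. min_set P X D \<and> pverts K \<subseteq> D))"

text \<open>
  The family \<open>X\<langle>\<mu>\<rangle>\<close>, as the set of all members whose vertices lie in the type \<open>'h\<close>.  It is closed
  under isomorphism, and for an infinite type \<open>'h\<close> it contains a representative of every
  isomorphism class in \<open>X\<langle>\<mu>\<rangle>\<close>.
\<close>

definition excellent_family ::
    "'a pair_pre_digraph \<Rightarrow> ('a pair_pre_digraph \<Rightarrow> 'a set \<Rightarrow> bool) \<Rightarrow> 'h pair_pre_digraph set"
  where
  "excellent_family X P = {H. simple_graph H \<and> excellent H P X}"

end

theory Submission
  imports Defs
begin

text \<open>
  All six parameters are compared through their minimum sets. A minimum (total) dominating set of
  the product is thin: it contains at most two vertices of each block \<open>F\<^sub>i\<close>
  (\<open>min_set_thin\<close>). Three or more vertices of one block could be traded for a single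
  vertex of that block, which still dominates all neighbouring blocks, together with a single
  vertex of a neighbouring block, which dominates the whole block \<open>F\<^sub>i\<close>. As
  every block has at least three vertices, the complement of a thin set meets every block, and an
  induced subgraph meeting every block inherits connectedness, and the absence of isolated
  vertices, from the connected graph \<open>G\<close> with at least two vertices
  (\<open>thin_dominating_restrained\<close>, \<open>thin_dominating_outer_connected\<close>).
  Hence every minimum (total) dominating set is automatically restrained and outer-connected;
  since these notions are specialisations of (total) domination, the minimum sets of the three
  parameters coincide, and excellence depends on a parameter only through its minimum sets
  (\<open>min_set_eq_if_min_sets_satisfy\<close>, \<open>excellent_family_cong\<close>).

  If each block has domination number at least three, a thin set cannot dominate a block from
  within. So a thin dominating set has, for each block, a vertex in an adjacent block, and this
  vertex is a neighbour of every vertex of the block: the set is even total dominating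
  (\<open>thin_dominating_total\<close>). Thus the minimum dominating and the minimum total
  dominating sets coincide as well.
\<close>

section \<open>Minimum sets of comparable properties\<close>

lemma min_card_le: "P X D \<Longrightarrow> min_card P X \<le> card D"
  unfolding min_card_def by (rule Least_le) blast

lemma min_set_exists:
  assumes "P X D"
  obtains M where "min_set P X M"
proof -
  have "\<exists>M. P X M \<and> card M = min_card P X"
    unfolding min_card_def by (rule LeastI_ex) (use assms in blast)
  then show thesis using that by (auto simp: min_set_def)
qed

text \<open>
  If neither property is satisfiable, both sides are the empty predicate; otherwise a minimum set
  for the weaker property witnesses that the two minima are equal.
\<close>

lemma min_set_eq_if_min_sets_satisfy:
  assumes stronger: "\<And>D. Q X D \<Longrightarrow> P X D"
    and minimum: "\<And>D. min_set P X D \<Longrightarrow> Q X D"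
  shows "min_set Q X = min_set P X"
proof (cases "\<exists>D. P X D")
  case True
  then obtain M where M: "min_set P X M" using min_set_exists[of P X] by blast
  then have "min_card Q X \<le> min_card P X"
    using min_card_le[of Q X M] minimum by (simp add: min_set_def)
  moreover obtain N where "min_set Q X N" using min_set_exists[of Q X M] minimum M by blast
  then have "min_card P X \<le> min_card Q X"
    using min_card_le[of P X N] stronger by (simp add: min_set_def)
  ultimately have "min_card Q X = min_card P X" by simp
  then show ?thesis using stronger minimum by (auto simp: min_set_def fun_eq_iff)
next
  case False
  then show ?thesis using stronger by (auto simp: min_set_def fun_eq_iff)
qed

lemma excellent_family_cong:
  "min_set P X = min_set Q X \<Longrightarrow> excellent_family X P = excellent_family X Q"
  by (simp add: excellent_family_def excellent_def)

section \<open>Products over a connected graph\<close>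

locale connected_lex_product =
  fixes G :: "'i pair_pre_digraph" and F :: "'i \<Rightarrow> 'a pair_pre_digraph"
  assumes base_graph: "pair_graph G"
    and base_connected: "Digraph_Component.connected (with_proj G)"
    and base_nontrivial: "card (pverts G) \<ge> 2"
    and block_graph: "k \<in> pverts G \<Longrightarrow> pair_graph (F k)"
    and block_disjoint: "disjoint_family_on (\<lambda>k. pverts (F k)) (pverts G)"
    and block_card: "k \<in> pverts G \<Longrightarrow> card (pverts (F k)) \<ge> 3"
begin

abbreviation X where "X \<equiv> gen_lex_prod G F"

definition thin :: "'a set \<Rightarrow> bool" where
  "thin D \<longleftrightarrow> (\<forall>i\<in>pverts G. card (D \<inter> pverts (F i)) \<le> 2)"

lemma base_in_verts: "(i, j) \<in> parcs G \<Longrightarrow> i \<in> pverts G \<and> j \<in> pverts G"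
  using base_graph pair_wf_digraph.in_arcsD1 pair_wf_digraph.in_arcsD2
  by (metis pair_digraph.pair_wf_digraph pair_graph.axioms(1))

lemma base_loopfree: "(i, j) \<in> parcs G \<Longrightarrow> i \<noteq> j"
  using base_graph
  by (metis fst_conv pair_digraph_def pair_graph_def pair_loopfree_digraph.pair_no_loops snd_conv)

lemma base_sym: "(i, j) \<in> parcs G \<Longrightarrow> (j, i) \<in> parcs G"
proof -
  interpret pair_graph G by (rule base_graph)
  show "(i, j) \<in> parcs G \<Longrightarrow> (j, i) \<in> parcs G"
    using pair_sym_arcs by (auto simp: symmetric_def elim: symE)
qed

lemma base_reach:
  assumes "i \<in> pverts G" "j \<in> pverts G"
  shows "(i, j) \<in> rtrancl_on (pverts G) (parcs G)"
proof -
  have "symcl (parcs G) = parcs G" using base_sym by (auto simp: symcl_def)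
  then show ?thesis using base_connected assms by (simp add: connected_conv)
qed

lemma base_neighbour:
  assumes "i \<in> pverts G"
  obtains j where "(i, j) \<in> parcs G"
proof -
  have "finite (pverts G)" using base_nontrivial card.infinite by fastforce
  then have "\<not> pverts G \<subseteq> {i}" using base_nontrivial card_mono[of "{i}" "pverts G"] by fastforce
  then obtain k where "k \<in> pverts G" "k \<noteq> i" by blast
  then show thesis
    using base_reach[OF assms, of k] that by (metis converse_rtrancl_on_cases)
qed

lemma block_unique:
  "\<lbrakk>v \<in> pverts (F i); v \<in> pverts (F j); i \<in> pverts G; j \<in> pverts G\<rbrakk> \<Longrightarrow> i = j"
  using block_disjoint by (auto simp: disjoint_family_on_def)

lemma block_arc_in_verts:
  "\<lbrakk>(u, v) \<in> parcs (F i); i \<in> pverts G\<rbrakk> \<Longrightarrow> u \<in> pverts (F i) \<and> v \<in> pverts (F i)"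
  using block_graph pair_wf_digraph.in_arcsD1 pair_wf_digraph.in_arcsD2
  by (metis pair_digraph.pair_wf_digraph pair_graph.axioms(1))

lemma block_finite: "i \<in> pverts G \<Longrightarrow> finite (pverts (F i))"
  using block_card card.infinite by fastforce

lemma verts_product: "pverts X = (\<Union>i\<in>pverts G. pverts (F i))"
  by (simp add: gen_lex_prod_def)

lemma finite_product: "finite (pverts X)"
proof -
  have "finite (pverts G)" using base_nontrivial card.infinite by fastforce
  then show ?thesis using block_finite by (simp add: verts_product)
qed

lemma arc_between_blocks:
  "\<lbrakk>(i, j) \<in> parcs G; u \<in> pverts (F i); v \<in> pverts (F j)\<rbrakk> \<Longrightarrow> (u, v) \<in> parcs X"
  using base_in_verts base_loopfree by (fastforce simp: gen_lex_prod_def)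

lemma arc_cases:
  assumes "(u, v) \<in> parcs X" "u \<in> pverts (F i)" "i \<in> pverts G"
  obtains (inside) "(u, v) \<in> parcs (F i)" "v \<in> pverts (F i)"
  | (across) j where "(i, j) \<in> parcs G" "v \<in> pverts (F j)"
proof -
  consider k where "k \<in> pverts G" "(u, v) \<in> parcs (F k)"
    | k j where "k \<in> pverts G" "u \<in> pverts (F k)" "v \<in> pverts (F j)" "(k, j) \<in> parcs G"
    using assms(1) by (auto simp: gen_lex_prod_def)
  then show thesis
  proof cases
    case 1
    then show ?thesis
      using inside block_arc_in_verts[of u v k] block_unique[of u i k] assms by blast
  next
    case 2
    then show ?thesis using across block_unique[of u i k] assms by blast
  qed
qed

section \<open>Vertex sets meeting every block\<close>

text \<open>
  A walk in \<open>G\<close> lifts to a walk between any chosen vertices of its blocks.  Two vertices of the same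
  block are joined through a neighbouring block, so the lift may start at any vertex of its first
  block and end at any vertex of its last block.
\<close>

lemma connected_if_meets_blocks:
  assumes U: "U \<subseteq> pverts X" and meets: "\<And>i. i \<in> pverts G \<Longrightarrow> U \<inter> pverts (F i) \<noteq> {}"
  shows "Digraph_Component.connected (induce_subgraph (with_proj X) U)"
proof -
  define A where "A = arcs_ends (induce_subgraph (with_proj X) U)"
  have A: "(u, v) \<in> symcl A" if "(u, v) \<in> parcs X" "u \<in> U" "v \<in> U" for u v
    using that by (force simp: A_def arcs_ends_conv symcl_def)
  have lift: "(u, w) \<in> rtrancl_on U (symcl A)"
    if "(i, k) \<in> rtrancl_on (pverts G) (parcs G)" "u \<in> U" "u \<in> pverts (F i)"
      "w \<in> U" "w \<in> pverts (F k)" for i k u w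
    using that
  proof (induction arbitrary: w rule: rtrancl_on_induct)
    case base
    obtain j where j: "(i, j) \<in> parcs G" using base_neighbour base(1) by blast
    then obtain y where y: "y \<in> U" "y \<in> pverts (F j)" using meets base_in_verts by blast
    have "(u, y) \<in> symcl A" "(y, w) \<in> symcl A"
      using A arc_between_blocks j base_sym y base by blast+
    then show ?case
      using y base by (meson rtrancl_on_into_rtrancl_on rtrancl_on_refl)
  next
    case (step k l)
    then obtain y where y: "y \<in> U" "y \<in> pverts (F k)" using meets base_in_verts by blast
    then have "(y, w) \<in> symcl A" using A arc_between_blocks step by blast
    then show ?case using step y by (meson rtrancl_on_into_rtrancl_on)
  qed
  have "(u, v) \<in> rtrancl_on U (symcl A)" if uv: "u \<in> U" "v \<in> U" for u v
  proof -
    obtain i k where "i \<in> pverts G" "u \<in> pverts (F i)" "k \<in> pverts G" "v \<in> pverts (F k)"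
      using U uv unfolding verts_product by blast
    then show ?thesis using lift base_reach uv by blast
  qed
  moreover have "U \<noteq> {}" using base_nontrivial meets by fastforce
  ultimately show ?thesis by (simp add: connected_conv A_def)
qed

lemma complement_of_thin_meets_blocks:
  assumes "thin D" "i \<in> pverts G"
  shows "(pverts X - D) \<inter> pverts (F i) \<noteq> {}"
proof
  assume "(pverts X - D) \<inter> pverts (F i) = {}"
  then have "D \<inter> pverts (F i) = pverts (F i)" using assms(2) by (auto simp: verts_product)
  then show False using assms block_card[of i] by (fastforce simp: thin_def)
qed

lemma thin_dominating_restrained:
  assumes "thin D" "dominating X D"
  shows "restrained_dominating X D"
  unfolding restrained_dominating_def
proof (intro conjI ballI)
  fix v assume "v \<in> pverts X - D"
  then obtain i where i: "i \<in> pverts G" "v \<in> pverts (F i)" by (auto simp: verts_product)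
  then obtain j where j: "(i, j) \<in> parcs G" using base_neighbour by blast
  then obtain u where "u \<in> pverts X - D" "u \<in> pverts (F j)"
    using complement_of_thin_meets_blocks assms(1) base_in_verts by blast
  then show "\<exists>u\<in>pverts X - D. (v, u) \<in> parcs X" using arc_between_blocks i j by blast
qed (rule assms(2))

lemma thin_dominating_outer_connected:
  "\<lbrakk>thin D; dominating X D\<rbrakk> \<Longrightarrow> outer_connected_dominating X D"
  using connected_if_meets_blocks[of "pverts X - D"] complement_of_thin_meets_blocks
  by (simp add: outer_connected_dominating_def)

section \<open>Minimum dominating sets are thin\<close>

definition trade :: "'a set \<Rightarrow> 'i \<Rightarrow> 'a \<Rightarrow> 'a \<Rightarrow> 'a set" where
  "trade D i x y = insert x (insert y (D - pverts (F i)))"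

lemma trade_subset:
  assumes "D \<subseteq> pverts X" "(i, j) \<in> parcs G" "x \<in> pverts (F i)" "y \<in> pverts (F j)"
  shows "trade D i x y \<subseteq> pverts X"
  using assms base_in_verts by (auto simp: trade_def verts_product)

text \<open>
  The vertices \<open>x\<close> and \<open>y\<close> dominate whatever the removed vertices did.  A vertex whose dominator
  is traded away lies in the block itself, where \<open>y\<close> takes over, or in a
  neighbouring block, where \<open>x\<close> does.
\<close>

lemma trade_covers:
  assumes "D \<subseteq> pverts X" "(i, j) \<in> parcs G" "x \<in> pverts (F i)" "y \<in> pverts (F j)"
    and v: "v \<in> pverts X" and u: "u \<in> D" "(v, u) \<in> parcs X"
  shows "\<exists>u\<in>trade D i x y. (v, u) \<in> parcs X"
proof (cases "u \<in> pverts (F i)")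
  case True
  obtain a where a: "a \<in> pverts G" "v \<in> pverts (F a)" using v by (auto simp: verts_product)
  from u(2) a(2) a(1) show ?thesis
  proof (cases rule: arc_cases)
    case inside
    then have "a = i" using True block_unique a base_in_verts assms(2) by blast
    then have "(v, y) \<in> parcs X" using a assms arc_between_blocks by blast
    then show ?thesis by (auto simp: trade_def)
  next
    case (across b)
    then have "b = i" using True block_unique base_in_verts assms(2) by blast
    then have "(v, x) \<in> parcs X" using a across assms arc_between_blocks by blast
    then show ?thesis by (auto simp: trade_def)
  qed
next
  case False
  then show ?thesis using u by (auto simp: trade_def)
qed

lemma trade_total_dominating:
  assumes "total_dominating X D" "(i, j) \<in> parcs G" "x \<in> pverts (F i)" "y \<in> pverts (F j)"
  shows "total_dominating X (trade D i x y)"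
  using assms trade_subset[of D i j x y] trade_covers[of D i j x y]
  unfolding total_dominating_def by blast

lemma trade_dominating:
  assumes "dominating X D" and trade: "(i, j) \<in> parcs G" "x \<in> pverts (F i)" "y \<in> pverts (F j)"
  shows "dominating X (trade D i x y)"
  unfolding dominating_def
proof (intro conjI ballI)
  have D: "D \<subseteq> pverts X" using assms(1) by (simp add: dominating_def)
  then show "trade D i x y \<subseteq> pverts X" using trade by (rule trade_subset)
  fix v assume v: "v \<in> pverts X - trade D i x y"
  show "\<exists>u\<in>trade D i x y. (v, u) \<in> parcs X"
  proof (cases "v \<in> D")
    case True
    then have "v \<in> pverts (F i)" using v by (auto simp: trade_def)
    then have "(v, y) \<in> parcs X" using trade arc_between_blocks by blast
    then show ?thesis by (auto simp: trade_def)
  next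
    case False
    then obtain u where "u \<in> D" "(v, u) \<in> parcs X"
      using assms(1) v by (auto simp: dominating_def)
    then show ?thesis using trade_covers[OF D trade] v by blast
  qed
qed

lemma card_trade:
  assumes "finite D" "card (D \<inter> pverts (F i)) \<ge> 3"
  shows "card (trade D i x y) < card D"
proof -
  have "card D = card (D \<inter> pverts (F i)) + card (D - pverts (F i))"
    using card_Int_Diff[of D "pverts (F i)"] assms by simp
  moreover have "card (trade D i x y) \<le> card (D - pverts (F i)) + 2"
    using assms(1) by (simp add: trade_def card_insert_if)
  ultimately show ?thesis using assms(2) by linarith
qed

text \<open>
  A trade in an overfull block removes at least three vertices and adds at most two, contradicting
  minimality.  Closure under trades is all that domination and total domination must provide.
\<close>

lemma min_set_thin:
  assumes tradable: "\<And>i j x y. \<lbrakk>(i, j) \<in> parcs G; x \<in> pverts (F i); y \<in> pverts (F j)\<rbrakk>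
      \<Longrightarrow> P X (trade D i x y)"
    and D: "min_set P X D" "D \<subseteq> pverts X"
  shows "thin D"
  unfolding thin_def
proof (rule ballI, rule ccontr)
  fix i assume i: "i \<in> pverts G" and "\<not> card (D \<inter> pverts (F i)) \<le> 2"
  then have big: "card (D \<inter> pverts (F i)) \<ge> 3" by simp
  obtain j where j: "(i, j) \<in> parcs G" using base_neighbour i by blast
  then obtain x y where "x \<in> pverts (F i)" "y \<in> pverts (F j)"
    using base_in_verts[OF j] block_card
    by (metis all_not_in_conv card.empty not_numeral_le_zero)
  then have "min_card P X \<le> card (trade D i x y)" using tradable j min_card_le by blast
  moreover have "finite D" using D(2) finite_product finite_subset by blast
  ultimately show False using card_trade[OF _ big, of x y] D(1) by (simp add: min_set_def)
qed

lemma min_dominating_thin: "min_set dominating X D \<Longrightarrow> thin D"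
  by (rule min_set_thin[of dominating D])
    (auto simp: min_set_def intro: trade_dominating, auto simp: dominating_def)

lemma min_total_dominating_thin: "min_set total_dominating X D \<Longrightarrow> thin D"
  by (rule min_set_thin[of total_dominating D])
    (auto simp: min_set_def intro: trade_total_dominating, auto simp: total_dominating_def)

section \<open>Coincidence of the minimum sets\<close>

lemma total_dominating_imp_dominating: "total_dominating Y D \<Longrightarrow> dominating Y D"
  by (auto simp: total_dominating_def dominating_def)

lemma min_sets_restrained: "min_set restrained_dominating X = min_set dominating X"
  using min_dominating_thin thin_dominating_restrained
  by (intro min_set_eq_if_min_sets_satisfy) (auto simp: restrained_dominating_def min_set_def)

lemma min_sets_outer_connected: "min_set outer_connected_dominating X = min_set dominating X"
  using min_dominating_thin thin_dominating_outer_connected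
  by (intro min_set_eq_if_min_sets_satisfy) (auto simp: outer_connected_dominating_def min_set_def)

lemma min_sets_total_restrained:
  "min_set total_restrained_dominating X = min_set total_dominating X"
  using min_total_dominating_thin thin_dominating_restrained total_dominating_imp_dominating
  by (intro min_set_eq_if_min_sets_satisfy)
    (auto simp: total_restrained_dominating_def min_set_def)

lemma min_sets_total_outer_connected:
  "min_set total_outer_connected_dominating X = min_set total_dominating X"
  using min_total_dominating_thin thin_dominating_outer_connected total_dominating_imp_dominating
  by (intro min_set_eq_if_min_sets_satisfy)
    (auto simp: total_outer_connected_dominating_def min_set_def)

text \<open>
  Some vertex of each block is dominated from outside, because the at most two chosen vertices of
  the block do not dominate it; its dominator is adjacent to the whole block.
\<close>

lemma thin_dominating_total:
  assumes big: "\<And>k. k \<in> pverts G \<Longrightarrow> domination_number (F k) \<ge> 3"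
    and D: "thin D" "dominating X D"
  shows "total_dominating X D"
  unfolding total_dominating_def
proof (intro conjI ballI)
  show "D \<subseteq> pverts X" using D(2) by (simp add: dominating_def)
  fix x assume "x \<in> pverts X"
  then obtain i where i: "i \<in> pverts G" "x \<in> pverts (F i)" by (auto simp: verts_product)
  have "\<not> dominating (F i) (D \<inter> pverts (F i))"
    using big[OF i(1)] D(1) i(1) min_card_le[of dominating "F i" "D \<inter> pverts (F i)"]
    by (fastforce simp: thin_def)
  then obtain v where v: "v \<in> pverts (F i)" "v \<notin> D"
    "\<forall>u\<in>D \<inter> pverts (F i). (v, u) \<notin> parcs (F i)"
    by (auto simp: dominating_def)
  then have "v \<in> pverts X - D" using i by (auto simp: verts_product)
  then obtain u where u: "u \<in> D" "(v, u) \<in> parcs X" using D(2) by (auto simp: dominating_def)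
  from u(2) v(1) i(1) obtain j where "(i, j) \<in> parcs G" "u \<in> pverts (F j)"
    by (cases rule: arc_cases) (use u v in blast)+
  then show "\<exists>u\<in>D. (x, u) \<in> parcs X" using u i arc_between_blocks by blast
qed

lemma min_sets_total:
  assumes "\<And>k. k \<in> pverts G \<Longrightarrow> domination_number (F k) \<ge> 3"
  shows "min_set total_dominating X = min_set dominating X"
  using min_dominating_thin thin_dominating_total[OF assms] total_dominating_imp_dominating
  by (intro min_set_eq_if_min_sets_satisfy) (auto simp: min_set_def)

end

theorem theorem14:
  fixes n :: nat
    and G :: "nat pair_pre_digraph"
    and F :: "nat \<Rightarrow> 'a pair_pre_digraph"
  assumes "n \<ge> 2"
    and "simple_graph G"
    and "pverts G = {1..n}"
    and "Digraph_Component.connected (with_proj G)"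
    and "\<And>k. k \<in> {1..n} \<Longrightarrow> simple_graph (F k)"
    and "disjoint_family_on (\<lambda>k. pverts (F k)) {1..n}"
    and "\<And>k. k \<in> {1..n} \<Longrightarrow> card (pverts (F k)) \<ge> 3"
  shows
    "((excellent_family (gen_lex_prod G F) dominating :: 'h pair_pre_digraph set)
        = excellent_family (gen_lex_prod G F) restrained_dominating
      \<and> (excellent_family (gen_lex_prod G F) restrained_dominating :: 'h pair_pre_digraph set)
        = excellent_family (gen_lex_prod G F) outer_connected_dominating
      \<and> (excellent_family (gen_lex_prod G F) total_dominating :: 'h pair_pre_digraph set)
        = excellent_family (gen_lex_prod G F) total_restrained_dominating
      \<and> (excellent_family (gen_lex_prod G F) total_restrained_dominating :: 'h pair_pre_digraph set)
        = excellent_family (gen_lex_prod G F) total_outer_connected_dominating)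
     \<and>
     ((\<forall>k\<in>{1..n}. domination_number (F k) \<ge> 3) \<longrightarrow>
        (excellent_family (gen_lex_prod G F) dominating :: 'h pair_pre_digraph set)
          = excellent_family (gen_lex_prod G F) restrained_dominating
        \<and> (excellent_family (gen_lex_prod G F) restrained_dominating :: 'h pair_pre_digraph set)
          = excellent_family (gen_lex_prod G F) outer_connected_dominating
        \<and> (excellent_family (gen_lex_prod G F) outer_connected_dominating :: 'h pair_pre_digraph set)
          = excellent_family (gen_lex_prod G F) total_dominating
        \<and> (excellent_family (gen_lex_prod G F) total_dominating :: 'h pair_pre_digraph set)
          = excellent_family (gen_lex_prod G F) total_restrained_dominating
        \<and> (excellent_family (gen_lex_prod G F) total_restrained_dominating :: 'h pair_pre_digraph set)
          = excellent_family (gen_lex_prod G F) total_outer_connected_dominating)"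
proof -
  interpret connected_lex_product G F
    using assms by (intro connected_lex_product.intro) (simp_all add: simple_graph_def)
  note min_sets = min_sets_restrained min_sets_outer_connected
    min_sets_total_restrained min_sets_total_outer_connected
  have "excellent_family X restrained_dominating
        = (excellent_family X dominating :: 'h pair_pre_digraph set)"
    "excellent_family X outer_connected_dominating
        = (excellent_family X dominating :: 'h pair_pre_digraph set)"
    "excellent_family X total_restrained_dominating
        = (excellent_family X total_dominating :: 'h pair_pre_digraph set)"
    "excellent_family X total_outer_connected_dominating
        = (excellent_family X total_dominating :: 'h pair_pre_digraph set)"
    by (intro excellent_family_cong min_sets)+
  moreover have "excellent_family X total_dominating
        = (excellent_family X dominating :: 'h pair_pre_digraph set)"
    if "\<forall>k\<in>{1..n}. domination_number (F k) \<ge> 3"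
    using that assms(3) by (intro excellent_family_cong min_sets_total) auto
  ultimately show ?thesis by simp
qed

end
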